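(* Let $X$ be a Tychonoff space and let $\tau$ be a cardinal. Suppose $X$ has a minimal separating function set of cardinality $\tau$. Then there exists a set $D\subset (X\times X)\setminus\Delta_X$ of cardinality $\tau$ that is discrete and closed in $(X\times X)\setminus\Delta_X$.
   Context: $\Delta_X=\{\langle x,x\rangle : x\in X\}$ is the diagonal of $X$, and $(X\times X)\setminus\Delta_X$ has the subspace topology from the product $X\times X$. $C_p(X)$ is the set of continuous functions $X\to\mathbb{R}$ with the topology of pointwise convergence. A set $F\subset C_p(X)$ is a separating function set for $X$ if for every two distinct $x,y\in X$ there is $f\in F$ with $f(x)\neq f(y)$; it is a minimal separating function set if it is separating and no proper subset of $F$ is separating. *)

theory Defs
  imports "HOL-Analysis.Analysis"
begin

unbundle cardinal_syntax
no_notation Set_Algebras.elt_set_eq (infix "=o" 50)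

definition tychonoff_space :: "'a topology \<Rightarrow> bool" where
  "tychonoff_space X \<longleftrightarrow> t1_space X \<and> completely_regular_space X"

text \<open>Points of a product topology are extensional functions, so each continuous real-valued
  function on the carrier of \<open>X\<close> is exactly one point of \<open>Cp X\<close>: it is \<open>undefined\<close> off the carrier.\<close>

definition Cp :: "'a topology \<Rightarrow> ('a \<Rightarrow> real) topology" where
  "Cp X = subtopology (product_topology (\<lambda>_. euclideanreal) (topspace X))
            {f. continuous_map X euclideanreal f}"

definition separating_function_set :: "'a topology \<Rightarrow> ('a \<Rightarrow> real) set \<Rightarrow> bool" where
  "separating_function_set X F \<longleftrightarrow>
     F \<subseteq> topspace (Cp X) \<and>
     (\<forall>x\<in>topspace X. \<forall>y\<in>topspace X. x \<noteq> y \<longrightarrow> (\<exists>f\<in>F. f x \<noteq> f y))"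

definition minimal_separating_function_set :: "'a topology \<Rightarrow> ('a \<Rightarrow> real) set \<Rightarrow> bool" where
  "minimal_separating_function_set X F \<longleftrightarrow>
     separating_function_set X F \<and> (\<forall>G. G \<subset> F \<longrightarrow> \<not> separating_function_set X G)"

definition off_diagonal :: "'a topology \<Rightarrow> ('a \<times> 'a) topology" where
  "off_diagonal X =
     subtopology (prod_topology X X) (topspace X \<times> topspace X - Id_on (topspace X))"

definition discrete_in :: "'a topology \<Rightarrow> 'a set \<Rightarrow> bool" where
  "discrete_in Y D \<longleftrightarrow> D \<subseteq> topspace Y \<and> subtopology Y D = discrete_topology D"

end

theory Submission
  imports Defs
begin

text \<open>Minimality yields, for every \<open>f\<close> in the family \<open>F\<close>, a pair of distinct points separated by
  \<open>f\<close> and by no other member of \<open>F\<close>. The open sets \<open>{(x, y). f x \<noteq> f y}\<close> with \<open>f \<in> F\<close> cover the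
  complement of the diagonal, and each contains exactly one of the chosen pairs, so the set of
  chosen pairs is closed, discrete and in bijection with \<open>F\<close>.\<close>

text \<open>In a T1 space every neighbourhood of a limit point of \<open>D\<close> meets
  \<open>D\<close> in an infinite set, so the last assumption leaves \<open>D\<close> without limit
  points. An empty derived set gives both closedness and discreteness.\<close>

lemma t1_space_closed_discrete:
  assumes "t1_space Y" and "D \<subseteq> topspace Y"
    and "\<And>p. p \<in> topspace Y \<Longrightarrow> \<exists>U. openin Y U \<and> p \<in> U \<and> finite (D \<inter> U)"
  shows "discrete_in Y D" and "closedin Y D"
proof -
  have "Y derived_set_of D = {}"
    using assms(1,3) unfolding t1_space_derived_set_of_infinite_openin by blast
  then show "discrete_in Y D" "closedin Y D"
    using assms(2) subtopology_eq_discrete_topology_gen [of D Y]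
    by (simp_all add: discrete_in_def closedin_contains_derived_set inf.absorb2)
qed

lemma openin_off_diagonal_neq:
  assumes "continuous_map X euclideanreal f"
  shows "openin (off_diagonal X) {p \<in> topspace (off_diagonal X). f (fst p) \<noteq> f (snd p)}"
proof -
  have fst: "continuous_map (off_diagonal X) euclideanreal (\<lambda>p. f (fst p))"
    and snd: "continuous_map (off_diagonal X) euclideanreal (\<lambda>p. f (snd p))"
    unfolding off_diagonal_def
    using continuous_map_compose [OF continuous_map_fst assms]
      continuous_map_compose [OF continuous_map_snd assms]
    by (auto simp: o_def intro: continuous_map_from_subtopology)
  \<comment> \<open>Passing to the difference makes the set a preimage of an open set of reals under
    a single continuous map.\<close>
  have "openin (off_diagonal X)
          {p \<in> topspace (off_diagonal X). f (fst p) - f (snd p) \<in> - {0}}"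
    by (rule openin_continuous_map_preimage [OF continuous_map_diff [OF fst snd]])
       (simp add: open_Compl)
  then show ?thesis
    by simp
qed

text \<open>Removing \<open>f\<close> destroys separation, so some pair of distinct points is not
  separated by \<open>F - {f}\<close>. Since \<open>F\<close> separates this pair, the member that
  does so must be \<open>f\<close>.\<close>

lemma minimal_separating_unique_pair:
  assumes "minimal_separating_function_set X F" and "f \<in> F"
  obtains x y where "x \<in> topspace X" "y \<in> topspace X" "\<And>g. g \<in> F \<Longrightarrow> g x \<noteq> g y \<longleftrightarrow> g = f"
proof -
  have sep: "separating_function_set X F" and "\<not> separating_function_set X (F - {f})"
    using assms unfolding minimal_separating_function_set_def by blast+
  then obtain x y where xy: "x \<in> topspace X" "y \<in> topspace X" "x \<noteq> y"
    and eq: "\<And>g. g \<in> F - {f} \<Longrightarrow> g x = g y"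
    unfolding separating_function_set_def by blast
  moreover obtain h where "h \<in> F" "h x \<noteq> h y"
    using sep xy unfolding separating_function_set_def by blast
  ultimately show thesis
    using that by (metis DiffI singletonD)
qed

theorem proposition2p2:
  fixes X :: "'a topology" and \<tau> :: "'c rel"
  assumes "tychonoff_space X"
    and "Card_order \<tau>"
    and "\<exists>F. minimal_separating_function_set X F \<and> |F| =o \<tau>"
  shows "\<exists>D. D \<subseteq> topspace X \<times> topspace X - Id_on (topspace X) \<and> |D| =o \<tau> \<and>
             discrete_in (off_diagonal X) D \<and> closedin (off_diagonal X) D"
proof -
  obtain F where F: "minimal_separating_function_set X F" and card: "|F| =o \<tau>"
    using assms(3) by blast
  then have sep: "separating_function_set X F"
    by (simp add: minimal_separating_function_set_def)
  have "\<exists>p. p \<in> topspace X \<times> topspace X \<and> (\<forall>g\<in>F. g (fst p) \<noteq> g (snd p) \<longleftrightarrow> g = f)"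
    if f: "f \<in> F" for f
    using minimal_separating_unique_pair [OF F f] by (metis fst_conv mem_Sigma_iff snd_conv)
  then obtain q where q: "\<And>f. f \<in> F \<Longrightarrow> q f \<in> topspace X \<times> topspace X"
    and uniq: "\<And>f g. f \<in> F \<Longrightarrow> g \<in> F \<Longrightarrow> g (fst (q f)) \<noteq> g (snd (q f)) \<longleftrightarrow> g = f"
    by metis
  define D where "D = q ` F"
  have top: "topspace (off_diagonal X) = topspace X \<times> topspace X - Id_on (topspace X)"
    by (auto simp: off_diagonal_def)
  \<comment> \<open>The pair \<open>q f\<close> lies off the diagonal because \<open>f\<close>
    itself takes different values at its coordinates.\<close>
  have D: "D \<subseteq> topspace (off_diagonal X)"
    using q uniq unfolding D_def top by (fastforce simp: Id_on_def)
  \<comment> \<open>The pair \<open>q f\<close> determines \<open>f\<close> as the only member of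
    \<open>F\<close> that separates it.\<close>
  have "inj_on q F"
    using uniq by (metis inj_onI)
  then have "|D| =o |F|"
    unfolding D_def by (metis card_of_ordIsoI inj_on_imp_bij_betw ordIso_symmetric)
  then have "|D| =o \<tau>"
    using card ordIso_transitive by blast
  moreover have "t1_space (off_diagonal X)"
    using assms(1) unfolding off_diagonal_def tychonoff_space_def
    by (simp add: t1_space_subtopology t1_space_prod_topology)
  moreover have "\<exists>U. openin (off_diagonal X) U \<and> p \<in> U \<and> finite (D \<inter> U)"
    if p: "p \<in> topspace (off_diagonal X)" for p
  proof -
    obtain f where f: "f \<in> F" "f (fst p) \<noteq> f (snd p)"
      using p sep unfolding top separating_function_set_def by (cases p) (clarsimp simp: Id_on_def, metis)
    let ?U = "{p \<in> topspace (off_diagonal X). f (fst p) \<noteq> f (snd p)}"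
    have "continuous_map X euclideanreal f"
      using f sep by (auto simp: separating_function_set_def Cp_def)
    \<comment> \<open>If \<open>q g\<close> lies in \<open>?U\<close>, then \<open>f\<close>
      separates the pair chosen for \<open>g\<close>, which forces \<open>f = g\<close>.\<close>
    moreover have "D \<inter> ?U \<subseteq> {q f}"
      using uniq f(1) by (auto simp: D_def)
    ultimately have "openin (off_diagonal X) ?U" "finite (D \<inter> ?U)"
      by (simp_all add: openin_off_diagonal_neq finite_subset)
    then show ?thesis
      using p f(2) by (intro exI [of _ ?U]) simp
  qed
  ultimately show ?thesis
    using t1_space_closed_discrete [of "off_diagonal X" D] D unfolding top by blast
qed

end
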